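(* Let $R$ be the set of real numbers $r$ such that $\mathrm{NRel}(G;r)=0$ for some finite simple graph $G$ (not necessarily connected). Then the closure of $R$ contains the interval $[1,2]$.
   Context: For a finite simple undirected graph $G$ with $n\geq 1$ nodes, a connected set of $G$ is a nonempty subset of nodes inducing a connected subgraph, and $c_k$ denotes the number of connected sets of $G$ of order $k$. The node reliability polynomial of $G$ is $\mathrm{NRel}(G;p)=\sum_{k=1}^n c_k p^k(1-p)^{n-k}$. *)

theory Defs
  imports "HOL-Analysis.Analysis" "Graph_Theory.Graph_Theory"
begin

text \<open>
  Undirected graphs are symmetric digraphs: a finite simple undirected graph is a
  \<^const>\<open>pair_graph\<close> (finite, loop-free, symmetric, without parallel arcs). Connectedness
  of a subgraph is \<^const>\<open>Digraph_Component.connected\<close>, not the topological notion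
  \<^const>\<open>Topological_Spaces.connected\<close>.
\<close>

definition connected_set :: "('a, 'b) pre_digraph \<Rightarrow> 'a set \<Rightarrow> bool" where
  "connected_set G S \<longleftrightarrow>
     S \<noteq> {} \<and> S \<subseteq> verts G \<and> Digraph_Component.connected (G \<restriction> S)"

definition num_connected_sets :: "('a, 'b) pre_digraph \<Rightarrow> nat \<Rightarrow> nat" where
  "num_connected_sets G k = card {S. connected_set G S \<and> card S = k}"

definition NRel :: "('a, 'b) pre_digraph \<Rightarrow> real \<Rightarrow> real" where
  "NRel G p = (\<Sum>k = 1..card (verts G).
     real (num_connected_sets G k) * p ^ k * (1 - p) ^ (card (verts G) - k))"

text \<open>
  Every finite graph is isomorphic to one whose nodes are natural numbers, so restricting the
  node type to \<^typ>\<open>nat\<close> loses no root.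
\<close>

definition NRel_real_roots :: "real set" where
  "NRel_real_roots =
     {r. \<exists>G :: nat pair_pre_digraph.
        pair_graph G \<and> pverts G \<noteq> {} \<and> NRel (with_proj G) r = 0}"

end

theory Submission
  imports Defs
begin

text \<open>
  Let \<open>G\<close> be the disjoint union of \<open>i\<close> edges and \<open>m - i\<close> isolated nodes, where \<open>0 < i \<le> m\<close>.
  Its connected sets are the \<open>m + i\<close> singletons and the \<open>i\<close> edges, so that
  \<open>NRel(G;p) = p (1 - p)^(m + i - 2) ((m + i) (1 - p) + i p)\<close>, which vanishes at \<open>p = 1 + i/m\<close>.
  Thus every rational number in \<open>(1,2]\<close> is a root.
\<close>

text \<open>Edges join \<open>k\<close> to \<open>k + m\<close> for \<open>k < i\<close>, so the two
  ends of an edge agree modulo \<open>m\<close>; the nodes from \<open>i\<close> to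
  \<open>m - 1\<close> stay isolated.\<close>

definition matching_graph :: "nat \<Rightarrow> nat \<Rightarrow> nat pair_pre_digraph" where
  "matching_graph m i = \<lparr> pverts = {..<m + i},
     parcs = (\<Union>k<i. {(k, k + m), (k + m, k)}) \<rparr>"

lemma pverts_matching_graph [simp]: "pverts (matching_graph m i) = {..<m + i}"
  and parcs_matching_graph:
    "parcs (matching_graph m i) = (\<Union>k<i. {(k, k + m), (k + m, k)})"
  by (simp_all add: matching_graph_def)

lemma pair_graph_matching_graph:
  assumes "0 < m"
  shows "pair_graph (matching_graph m i)"
  using assms
  by unfold_locales (auto simp: parcs_matching_graph symmetric_def intro!: symI)

text \<open>Turns connectedness into reachability inside \<open>S\<close>, which allows induction
  along paths.\<close>

lemma connected_set_with_proj_iff: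
  "connected_set (with_proj G) S \<longleftrightarrow> S \<noteq> {} \<and> S \<subseteq> pverts G \<and>
     (\<forall>u\<in>S. \<forall>v\<in>S. (u, v) \<in> rtrancl_on S ((parcs G \<inter> S \<times> S)\<^sup>s))"
proof -
  have "arcs_ends (with_proj G \<restriction> S) = parcs G \<inter> S \<times> S"
    by (auto simp: arcs_ends_conv image_iff)
  then show ?thesis
    by (auto simp: connected_set_def connected_conv)
qed

lemma connected_set_matching_graph_iff:
  assumes "0 < m" "i \<le> m"
  shows "connected_set (with_proj (matching_graph m i)) S \<longleftrightarrow>
    (\<exists>v<m + i. S = {v}) \<or> (\<exists>k<i. S = {k, k + m})"
    (is "?conn \<longleftrightarrow> ?rhs")
proof
  assume ?conn
  then obtain x where "x \<in> S" and sub: "S \<subseteq> {..<m + i}"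
    and reach: "\<And>u v. u \<in> S \<Longrightarrow> v \<in> S \<Longrightarrow>
      (u, v) \<in> rtrancl_on S ((parcs (matching_graph m i) \<inter> S \<times> S)\<^sup>s)"
    unfolding connected_set_with_proj_iff by auto
  define c where "c = x mod m"
  \<comment> \<open>The components of the graph are the residue classes modulo \<open>m\<close>.\<close>
  have "v mod m = c" if "v \<in> S" for v
    using reach[OF \<open>x \<in> S\<close> that] unfolding c_def
    by (induction rule: rtrancl_on_induct)
      (auto simp: symcl_def parcs_matching_graph)
  moreover have "v = v mod m \<or> v = v mod m + m" if "v \<in> S" for v
  proof -
    have "v < m + m"
      using that sub assms by auto
    then show ?thesis
      by (auto simp: mod_if)
  qed
  ultimately have "S \<subseteq> {c, c + m}"
    by fastforce
  then have "S = {c} \<or> S = {c + m} \<or> S = {c, c + m}"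
    using \<open>x \<in> S\<close> by blast
  \<comment> \<open>If \<open>c + m\<close> lies in \<open>S\<close>, then
    \<open>c + m < m + i\<close> forces \<open>c < i\<close>, so \<open>{c, c + m}\<close> is an
    edge.\<close>
  then show ?rhs
    using sub by auto
next
  assume ?rhs
  then show ?conn
  proof
    assume "\<exists>v<m + i. S = {v}"
    then show ?conn
      by (auto simp: connected_set_with_proj_iff)
  next
    assume "\<exists>k<i. S = {k, k + m}"
    then obtain k where k: "k < i" and S: "S = {k, k + m}"
      by blast
    have "{(k, k + m), (k + m, k)} \<subseteq> (parcs (matching_graph m i) \<inter> S \<times> S)\<^sup>s"
      using k by (auto simp: S parcs_matching_graph symcl_def)
    then show ?conn
      using k unfolding connected_set_with_proj_iff
      by (auto simp: S intro: rtrancl_on_into_rtrancl_on[OF rtrancl_on_refl])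
  qed
qed

lemma num_connected_sets_matching_graph:
  assumes "0 < m" "i \<le> m"
  shows "num_connected_sets (with_proj (matching_graph m i)) k =
    (if k = 1 then m + i else if k = 2 then i else 0)"
proof -
  have "{S. connected_set (with_proj (matching_graph m i)) S \<and> card S = k} =
      (if k = 1 then (\<lambda>v. {v}) ` {..<m + i}
       else if k = 2 then (\<lambda>v. {v, v + m}) ` {..<i} else {})"
    using assms by (auto simp: connected_set_matching_graph_iff card_insert_if)
  \<comment> \<open>A crosswise coincidence \<open>v = w + m\<close>, \<open>v + m = w\<close> would
    give \<open>2 * m = 0\<close>.\<close>
  moreover have "inj_on (\<lambda>v. {v, v + m}) {..<i}"
    using assms by (auto simp: inj_on_def doubleton_eq_iff)
  ultimately show ?thesis
    by (simp add: num_connected_sets_def card_image)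
qed

lemma NRel_matching_graph:
  assumes "0 < i" "i \<le> m"
  shows "NRel (with_proj (matching_graph m i)) p =
    p * (1 - p) ^ (m + i - 2) * (real (m + i) * (1 - p) + real i * p)"
proof -
  define n where "n = m + i - 2"
  have n: "m + i - 1 = Suc n" "m + i - 2 = n"
    using assms by (auto simp: n_def)
  have "NRel (with_proj (matching_graph m i)) p =
      (\<Sum>k\<in>{1, 2}. real (num_connected_sets (with_proj (matching_graph m i)) k)
        * p ^ k * (1 - p) ^ (m + i - k))"
    unfolding NRel_def using assms
    \<comment> \<open>Both orders 1 and 2 lie in the range of summation, as \<open>m + i\<close> is
      at least 2; all other counts vanish.\<close>
    by (intro sum.mono_neutral_cong_right)
      (auto simp: num_connected_sets_matching_graph)
  also have "\<dots> = p * (1 - p) ^ n * (real (m + i) * (1 - p) + real i * p)"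
    using assms n
    by (simp add: num_connected_sets_matching_graph algebra_simps power2_eq_square)
  finally show ?thesis
    by (simp add: n_def)
qed

lemma rational_in_NRel_real_roots:
  assumes "0 < i" "i \<le> m"
  shows "1 + real i / real m \<in> NRel_real_roots"
proof -
  have "NRel (with_proj (matching_graph m i)) (1 + real i / real m) = 0"
    \<comment> \<open>Here \<open>1 - p = - i / m\<close>, so the two terms of the linear factor
      cancel.\<close>
    using assms by (simp add: NRel_matching_graph field_simps)
  moreover have "pair_graph (matching_graph m i)" "pverts (matching_graph m i) \<noteq> {}"
    using assms by (auto intro: pair_graph_matching_graph)
  ultimately show ?thesis
    unfolding NRel_real_roots_def by blast
qed

theorem theorem13:
  shows "{1..2} \<subseteq> closure NRel_real_roots"
proof -
  \<comment> \<open>The open interval leaves room for a rational strictly above \<open>r\<close>;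
    the endpoints return by taking closures.\<close>
  have "{1<..<2} \<subseteq> closure NRel_real_roots"
  proof
    fix r :: real
    assume r: "r \<in> {1<..<2}"
    have "\<exists>y\<in>NRel_real_roots. dist y r < e" if e: "0 < e" for e
    proof -
      \<comment> \<open>The bound 1 will give \<open>i \<le> m\<close>, the bound
        \<open>r - 1 + e\<close> the distance estimate.\<close>
      obtain q where q: "q \<in> \<rat>" "r - 1 < q" "q < min 1 (r - 1 + e)"
        using Rats_dense_in_real[of "r - 1" "min 1 (r - 1 + e)"] r e by auto
      obtain i m :: nat where "m \<noteq> 0" "\<bar>q\<bar> = real i / real m"
        using Rats_abs_nat_div_natE[OF q(1)] by metis
      then have im: "0 < m" "q = real i / real m"
        using q r by auto
      have "0 < real i / real m" "real i / real m < 1"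
        using q r im by auto
      then have "0 < i" "i \<le> m"
        using im(1) by (auto simp: zero_less_divide_iff)
      then have "1 + q \<in> NRel_real_roots"
        using im rational_in_NRel_real_roots by simp
      moreover have "dist (1 + q) r < e"
        using q by (simp add: dist_real_def)
      ultimately show ?thesis
        by blast
    qed
    then show "r \<in> closure NRel_real_roots"
      by (simp add: closure_approachable)
  qed
  then have "closure {1<..<2} \<subseteq> closure NRel_real_roots"
    by (rule closure_minimal) simp
  then show ?thesis
    by simp
qed

end
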